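(* Let $\mathbf{P}\colon\mathsf{C}^{\mathrm{op}}\to\mathsf{BA}$ be a Boolean doctrine with $\mathsf{C}$ small, and let $F=(F_X)_{X\in\mathsf{C}}$ be a family with $F_X\subseteq\mathbf{P}(X)$. The following are equivalent: (1) there is a class $\mathcal{M}$ of propositional models of $\mathbf{P}$ such that for every $X\in\mathsf{C}$, $F_X=\{\alpha\in\mathbf{P}(X)\mid\text{for all }(M,\mathfrak{m})\in\mathcal{M}\text{ and all }x\in M(X),\ x\in\mathfrak{m}_X(\alpha)\}$; (2) $F$ is a universal filter for $\mathbf{P}$; (3) $F$ is the (componentwise) intersection of the universal ultrafilters for $\mathbf{P}$ containing $F$. Moreover, the following three statements are also equivalent: (1') statement (1) with $\mathcal{M}$ nonempty; (2') $F$ is a consistent universal filter; (3') statement (3) holds and there exists a universal ultrafilter for $\mathbf{P}$ containing $F$.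
   Context: Categories have finite products; $\mathbf{t}$ terminal, $\mathrm{pr}_i$ projections. A Boolean doctrine is a functor $\mathbf{P}\colon\mathsf{C}^{\mathrm{op}}\to\mathsf{BA}$. A propositional model of $\mathbf{P}$ is a pair $(M,\mathfrak{m})$ with $M\colon\mathsf{C}\to\mathsf{Set}$ finite-product-preserving and $\mathfrak{m}\colon\mathbf{P}\Rightarrow\mathscr{P}\circ M^{\mathrm{op}}$ natural, where $\mathscr{P}\colon\mathsf{Set}^{\mathrm{op}}\to\mathsf{BA}$ is the power set functor with preimage maps. A universal filter for $\mathbf{P}$ is a family $(F_X)$, $F_X\subseteq\mathbf{P}(X)$, with $\mathbf{P}(f)(\alpha)\in F_X$ for all $f\colon X\to Y$, $\alpha\in F_Y$, and each $F_X$ a filter; it is consistent if $\bot_{\mathbf{P}(\mathbf{t})}\notin F_{\mathbf{t}}$. A universal ultrafilter is a universal filter $(G_X)$ such that additionally: if $\mathbf{P}(\mathrm{pr}_1)(\alpha_1)\lor\mathbf{P}(\mathrm{pr}_2)(\alpha_2)\in G_{X_1\times X_2}$ then $\alpha_1\in G_{X_1}$ or $\alpha_2\in G_{X_2}$, and $\bot_{\mathbf{P}(\mathbf{t})}\notin G_{\mathbf{t}}$. "Containing" means componentwise inclusion; the intersection of an empty family is understood componentwise as $\mathbf{P}(X)$. *)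

theory Defs
  imports "HOL-Library.FuncSet" "HOL-Library.Equipollence"
begin

section \<open>Small categories with finite products\<close>

record ('o, 'm) cat =
  Obj :: "'o set"
  Arr :: "'m set"
  Dom :: "'m \<Rightarrow> 'o"
  Cod :: "'m \<Rightarrow> 'o"
  Idn :: "'o \<Rightarrow> 'm"
  Cmp :: "'m \<Rightarrow> 'm \<Rightarrow> 'm"  \<comment> \<open>\<open>Cmp C g f\<close> is \<open>g\<close> after \<open>f\<close>\<close>

definition Hom :: "('o, 'm) cat \<Rightarrow> 'o \<Rightarrow> 'o \<Rightarrow> 'm set" where
  "Hom C X Y = {f \<in> Arr C. Dom C f = X \<and> Cod C f = Y}"

locale category =
  fixes C :: "('o, 'm) cat"
  assumes Dom_in: "f \<in> Arr C \<Longrightarrow> Dom C f \<in> Obj C"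
    and Cod_in: "f \<in> Arr C \<Longrightarrow> Cod C f \<in> Obj C"
    and Idn_in: "X \<in> Obj C \<Longrightarrow> Idn C X \<in> Hom C X X"
    and Cmp_in: "\<lbrakk>f \<in> Hom C X Y; g \<in> Hom C Y Z\<rbrakk> \<Longrightarrow> Cmp C g f \<in> Hom C X Z"
    and Cmp_Idn_right: "f \<in> Hom C X Y \<Longrightarrow> Cmp C f (Idn C X) = f"
    and Cmp_Idn_left: "f \<in> Hom C X Y \<Longrightarrow> Cmp C (Idn C Y) f = f"
    and Cmp_assoc: "\<lbrakk>f \<in> Hom C X Y; g \<in> Hom C Y Z; h \<in> Hom C Z W\<rbrakk>
      \<Longrightarrow> Cmp C h (Cmp C g f) = Cmp C (Cmp C h g) f"

definition is_terminal :: "('o, 'm) cat \<Rightarrow> 'o \<Rightarrow> bool" where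
  "is_terminal C T \<longleftrightarrow> T \<in> Obj C \<and> (\<forall>X\<in>Obj C. \<exists>!f. f \<in> Hom C X T)"

definition is_product :: "('o, 'm) cat \<Rightarrow> 'o \<Rightarrow> 'o \<Rightarrow> 'o \<Rightarrow> 'm \<Rightarrow> 'm \<Rightarrow> bool" where
  "is_product C X1 X2 Q p1 p2 \<longleftrightarrow>
     X1 \<in> Obj C \<and> X2 \<in> Obj C \<and> Q \<in> Obj C \<and> p1 \<in> Hom C Q X1 \<and> p2 \<in> Hom C Q X2 \<and>
     (\<forall>Z\<in>Obj C. \<forall>f1\<in>Hom C Z X1. \<forall>f2\<in>Hom C Z X2.
        \<exists>!h. h \<in> Hom C Z Q \<and> Cmp C p1 h = f1 \<and> Cmp C p2 h = f2)"

locale category_fp = category C for C :: "('o, 'm) cat" +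
  assumes ex_terminal: "\<exists>T. is_terminal C T"
    and ex_product: "\<lbrakk>X1 \<in> Obj C; X2 \<in> Obj C\<rbrakk> \<Longrightarrow> \<exists>Q p1 p2. is_product C X1 X2 Q p1 p2"


section \<open>Boolean algebras with explicit carrier\<close>

record 'b ba =
  carr :: "'b set"
  meet :: "'b \<Rightarrow> 'b \<Rightarrow> 'b"
  join :: "'b \<Rightarrow> 'b \<Rightarrow> 'b"
  neg :: "'b \<Rightarrow> 'b"
  bt :: "'b"
  tp :: "'b"

locale bool_alg =
  fixes A :: "'b ba"
  assumes meet_in: "\<lbrakk>x \<in> carr A; y \<in> carr A\<rbrakk> \<Longrightarrow> meet A x y \<in> carr A"
    and join_in: "\<lbrakk>x \<in> carr A; y \<in> carr A\<rbrakk> \<Longrightarrow> join A x y \<in> carr A"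
    and neg_in: "x \<in> carr A \<Longrightarrow> neg A x \<in> carr A"
    and bt_in: "bt A \<in> carr A"
    and tp_in: "tp A \<in> carr A"
    and meet_assoc: "\<lbrakk>x \<in> carr A; y \<in> carr A; z \<in> carr A\<rbrakk>
      \<Longrightarrow> meet A (meet A x y) z = meet A x (meet A y z)"
    and join_assoc: "\<lbrakk>x \<in> carr A; y \<in> carr A; z \<in> carr A\<rbrakk>
      \<Longrightarrow> join A (join A x y) z = join A x (join A y z)"
    and meet_comm: "\<lbrakk>x \<in> carr A; y \<in> carr A\<rbrakk> \<Longrightarrow> meet A x y = meet A y x"
    and join_comm: "\<lbrakk>x \<in> carr A; y \<in> carr A\<rbrakk> \<Longrightarrow> join A x y = join A y x"
    and meet_absorb: "\<lbrakk>x \<in> carr A; y \<in> carr A\<rbrakk> \<Longrightarrow> meet A x (join A x y) = x"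
    and join_absorb: "\<lbrakk>x \<in> carr A; y \<in> carr A\<rbrakk> \<Longrightarrow> join A x (meet A x y) = x"
    and meet_join_distrib: "\<lbrakk>x \<in> carr A; y \<in> carr A; z \<in> carr A\<rbrakk>
      \<Longrightarrow> meet A x (join A y z) = join A (meet A x y) (meet A x z)"
    and join_bt: "x \<in> carr A \<Longrightarrow> join A x (bt A) = x"
    and meet_tp: "x \<in> carr A \<Longrightarrow> meet A x (tp A) = x"
    and meet_neg: "x \<in> carr A \<Longrightarrow> meet A x (neg A x) = bt A"
    and join_neg: "x \<in> carr A \<Longrightarrow> join A x (neg A x) = tp A"

definition ba_le :: "'b ba \<Rightarrow> 'b \<Rightarrow> 'b \<Rightarrow> bool" where
  "ba_le A x y \<longleftrightarrow> meet A x y = x"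

definition ba_hom :: "'b ba \<Rightarrow> 'c ba \<Rightarrow> ('b \<Rightarrow> 'c) \<Rightarrow> bool" where
  "ba_hom A B h \<longleftrightarrow> h \<in> carr A \<rightarrow> carr B \<and>
     (\<forall>x\<in>carr A. \<forall>y\<in>carr A. h (meet A x y) = meet B (h x) (h y)) \<and>
     (\<forall>x\<in>carr A. \<forall>y\<in>carr A. h (join A x y) = join B (h x) (h y)) \<and>
     (\<forall>x\<in>carr A. h (neg A x) = neg B (h x)) \<and>
     h (bt A) = bt B \<and> h (tp A) = tp B"

text \<open>The improper filter is allowed.\<close>

definition ba_filter :: "'b ba \<Rightarrow> 'b set \<Rightarrow> bool" where
  "ba_filter A F \<longleftrightarrow> F \<subseteq> carr A \<and> tp A \<in> F \<and>
     (\<forall>x\<in>F. \<forall>y\<in>F. meet A x y \<in> F) \<and>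
     (\<forall>x\<in>F. \<forall>y\<in>carr A. ba_le A x y \<longrightarrow> y \<in> F)"

definition powerset_ba :: "'u set \<Rightarrow> 'u set ba" where
  "powerset_ba S = \<lparr>carr = Pow S, meet = (\<inter>), join = (\<union>), neg = (\<lambda>x. S - x), bt = {}, tp = S\<rparr>"

lemma bool_alg_powerset_ba: "bool_alg (powerset_ba S)"
  by unfold_locales (auto simp: powerset_ba_def)


section \<open>Boolean doctrines\<close>

record ('o, 'm, 'b) doctrine =
  Fib :: "'o \<Rightarrow> 'b ba"
  Rdx :: "'m \<Rightarrow> 'b \<Rightarrow> 'b"

locale boolean_doctrine = category_fp C
  for C :: "('o, 'm) cat" and P :: "('o, 'm, 'b) doctrine" +
  assumes Fib_ba: "X \<in> Obj C \<Longrightarrow> bool_alg (Fib P X)"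
    and Rdx_hom: "f \<in> Hom C X Y \<Longrightarrow> ba_hom (Fib P Y) (Fib P X) (Rdx P f)"
    and Rdx_Idn: "\<lbrakk>X \<in> Obj C; \<alpha> \<in> carr (Fib P X)\<rbrakk> \<Longrightarrow> Rdx P (Idn C X) \<alpha> = \<alpha>"
    and Rdx_Cmp: "\<lbrakk>f \<in> Hom C X Y; g \<in> Hom C Y Z; \<alpha> \<in> carr (Fib P Z)\<rbrakk>
      \<Longrightarrow> Rdx P (Cmp C g f) \<alpha> = Rdx P f (Rdx P g \<alpha>)"


section \<open>Propositional models\<close>

text \<open>The category of sets is rendered as the sets over a type \<open>'u\<close> and the functions between
  them; a set-valued functor is given by its action on objects and on arrows, the latter being
  relevant only on the set assigned to the domain. The type \<open>'u\<close> plays the role of the universe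
  of small sets: a category or a doctrine is small relative to it if its arrows, respectively its
  fibres, inject into \<open>'u\<close>, and \<open>'u\<close> is taken to be infinite.\<close>

record ('o, 'm, 'u) set_functor =
  FOb :: "'o \<Rightarrow> 'u set"
  FAr :: "'m \<Rightarrow> 'u \<Rightarrow> 'u"

definition is_set_functor :: "('o, 'm) cat \<Rightarrow> ('o, 'm, 'u) set_functor \<Rightarrow> bool" where
  "is_set_functor C M \<longleftrightarrow>
     (\<forall>X\<in>Obj C. \<forall>Y\<in>Obj C. \<forall>f\<in>Hom C X Y. FAr M f \<in> FOb M X \<rightarrow> FOb M Y) \<and>
     (\<forall>X\<in>Obj C. \<forall>x\<in>FOb M X. FAr M (Idn C X) x = x) \<and>
     (\<forall>X\<in>Obj C. \<forall>Y\<in>Obj C. \<forall>Z\<in>Obj C. \<forall>f\<in>Hom C X Y. \<forall>g\<in>Hom C Y Z.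
        \<forall>x\<in>FOb M X. FAr M (Cmp C g f) x = FAr M g (FAr M f x))"

text \<open>Terminal objects go to one-element sets, and product cones to product cones of sets.\<close>

definition preserves_finite_products ::
    "('o, 'm) cat \<Rightarrow> ('o, 'm, 'u) set_functor \<Rightarrow> bool" where
  "preserves_finite_products C M \<longleftrightarrow>
     (\<forall>T. is_terminal C T \<longrightarrow> (\<exists>!x. x \<in> FOb M T)) \<and>
     (\<forall>X1 X2 Q p1 p2. is_product C X1 X2 Q p1 p2 \<longrightarrow>
        bij_betw (\<lambda>x. (FAr M p1 x, FAr M p2 x)) (FOb M Q) (FOb M X1 \<times> FOb M X2))"

type_synonym ('o, 'm, 'b, 'u) pmodel = "('o, 'm, 'u) set_functor \<times> ('o \<Rightarrow> 'b \<Rightarrow> 'u set)"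

definition propositional_model ::
    "('o, 'm) cat \<Rightarrow> ('o, 'm, 'b) doctrine \<Rightarrow> ('o, 'm, 'b, 'u) pmodel \<Rightarrow> bool" where
  "propositional_model C P = (\<lambda>(M, \<mm>).
     is_set_functor C M \<and> preserves_finite_products C M \<and>
     (\<forall>X\<in>Obj C. ba_hom (Fib P X) (powerset_ba (FOb M X)) (\<mm> X)) \<and>
     (\<forall>X\<in>Obj C. \<forall>Y\<in>Obj C. \<forall>f\<in>Hom C X Y. \<forall>\<alpha>\<in>carr (Fib P Y).
        \<mm> X (Rdx P f \<alpha>) = FAr M f -` \<mm> Y \<alpha> \<inter> FOb M X))"


section \<open>Universal filters and ultrafilters\<close>

definition universal_filter ::
    "('o, 'm) cat \<Rightarrow> ('o, 'm, 'b) doctrine \<Rightarrow> ('o \<Rightarrow> 'b set) \<Rightarrow> bool" where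
  "universal_filter C P F \<longleftrightarrow>
     (\<forall>X\<in>Obj C. \<forall>Y\<in>Obj C. \<forall>f\<in>Hom C X Y. \<forall>\<alpha>\<in>F Y. Rdx P f \<alpha> \<in> F X) \<and>
     (\<forall>X\<in>Obj C. ba_filter (Fib P X) (F X))"

text \<open>No terminal object or products are chosen: conditions on the terminal object and on \<open>X1 \<times> X2\<close> are imposed for
  every terminal object and every product cone. For families stable under reindexing this is
  the same as imposing them for one choice.\<close>

definition consistent_family ::
    "('o, 'm) cat \<Rightarrow> ('o, 'm, 'b) doctrine \<Rightarrow> ('o \<Rightarrow> 'b set) \<Rightarrow> bool" where
  "consistent_family C P F \<longleftrightarrow> (\<forall>T. is_terminal C T \<longrightarrow> bt (Fib P T) \<notin> F T)"

definition universal_ultrafilter ::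
    "('o, 'm) cat \<Rightarrow> ('o, 'm, 'b) doctrine \<Rightarrow> ('o \<Rightarrow> 'b set) \<Rightarrow> bool" where
  "universal_ultrafilter C P G \<longleftrightarrow>
     universal_filter C P G \<and>
     (\<forall>X1 X2 Q p1 p2. is_product C X1 X2 Q p1 p2 \<longrightarrow>
        (\<forall>\<alpha>1\<in>carr (Fib P X1). \<forall>\<alpha>2\<in>carr (Fib P X2).
           join (Fib P Q) (Rdx P p1 \<alpha>1) (Rdx P p2 \<alpha>2) \<in> G Q \<longrightarrow> \<alpha>1 \<in> G X1 \<or> \<alpha>2 \<in> G X2)) \<and>
     consistent_family C P G"

definition family_subset :: "('o, 'm) cat \<Rightarrow> ('o \<Rightarrow> 'b set) \<Rightarrow> ('o \<Rightarrow> 'b set) \<Rightarrow> bool" where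
  "family_subset C F G \<longleftrightarrow> (\<forall>X\<in>Obj C. F X \<subseteq> G X)"


section \<open>The properties of families being compared\<close>

definition valid_in_models ::
    "('o, 'm) cat \<Rightarrow> ('o, 'm, 'b) doctrine \<Rightarrow> ('o, 'm, 'b, 'u) pmodel set \<Rightarrow> ('o \<Rightarrow> 'b set) \<Rightarrow> bool"
  where
  "valid_in_models C P \<M> F \<longleftrightarrow>
     (\<forall>X\<in>Obj C. F X = {\<alpha> \<in> carr (Fib P X). \<forall>(M, \<mm>)\<in>\<M>. \<forall>x\<in>FOb M X. x \<in> \<mm> X \<alpha>})"

definition intersection_of_ultrafilters ::
    "('o, 'm) cat \<Rightarrow> ('o, 'm, 'b) doctrine \<Rightarrow> ('o \<Rightarrow> 'b set) \<Rightarrow> bool" where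
  "intersection_of_ultrafilters C P F \<longleftrightarrow>
     (\<forall>X\<in>Obj C. F X = {\<alpha> \<in> carr (Fib P X).
        \<forall>G. universal_ultrafilter C P G \<and> family_subset C F G \<longrightarrow> \<alpha> \<in> G X})"

end

theory Submission
  imports Defs
begin

text \<open>If \<open>F\<close> is a universal filter and \<open>\<beta> \<notin> F\<^sub>X\<close>, choose an ultrafilter \<open>U\<close> of \<open>\<^bold>P(X)\<close> that contains
  \<open>F\<^sub>X\<close> and omits \<open>\<beta>\<close>. The representable functor \<open>Hom(X, -)\<close> preserves products and becomes a
  propositional model by \<open>f \<in> \<mm>\<^sub>Y(\<alpha>) \<longleftrightarrow> \<^bold>P(f)(\<alpha>) \<in> U\<close>. All of \<open>F\<close> is valid in it since \<open>F\<close> is stable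
  under reindexing, whereas \<open>\<beta>\<close> fails at the identity of \<open>X\<close>. Hence a universal filter is the set of
  formulas valid in all models of it. Conversely, the formulas valid in one model form a universal
  ultrafilter, because a pair of counterexamples to \<open>\<alpha>\<^sub>1\<close> and \<open>\<alpha>\<^sub>2\<close> is an element of \<open>M(X\<^sub>1 \<times> X\<^sub>2)\<close>.\<close>

section \<open>Boolean algebras and the ultrafilter theorem\<close>

context bool_alg
begin

section \<open>Order and lattice laws of a Boolean algebra\<close>

lemma meet_idem: "x \<in> carr A \<Longrightarrow> meet A x x = x"
  using meet_absorb[of x "bt A"] by (simp add: join_bt bt_in)

lemma meet_bt: assumes "x \<in> carr A" shows "meet A (bt A) x = bt A"
proof -
  have "meet A (bt A) x = meet A (meet A x (neg A x)) x"
    using assms by (simp add: meet_neg)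
  also have "\<dots> = meet A (meet A x x) (neg A x)"
    using assms by (metis meet_assoc meet_comm neg_in)
  finally show ?thesis
    using assms by (simp add: meet_idem meet_neg)
qed

lemma le_trans:
  "\<lbrakk>ba_le A x y; ba_le A y z; x \<in> carr A; y \<in> carr A; z \<in> carr A\<rbrakk> \<Longrightarrow> ba_le A x z"
  unfolding ba_le_def by (metis meet_assoc)

lemma meet_le1: "\<lbrakk>x \<in> carr A; y \<in> carr A\<rbrakk> \<Longrightarrow> ba_le A (meet A x y) x"
  unfolding ba_le_def by (metis meet_assoc meet_comm meet_idem)

lemma meet_le2: "\<lbrakk>x \<in> carr A; y \<in> carr A\<rbrakk> \<Longrightarrow> ba_le A (meet A x y) y"
  by (metis meet_comm meet_le1)

lemma meet_greatest:
  "\<lbrakk>ba_le A z x; ba_le A z y; x \<in> carr A; y \<in> carr A; z \<in> carr A\<rbrakk> \<Longrightarrow> ba_le A z (meet A x y)"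
  unfolding ba_le_def by (metis meet_assoc)

lemma meet_mono_left:
  assumes "ba_le A x y" "x \<in> carr A" "y \<in> carr A" "z \<in> carr A"
  shows "ba_le A (meet A x z) (meet A y z)"
proof (rule meet_greatest)
  show "ba_le A (meet A x z) y"
    by (rule le_trans[OF meet_le1 assms(1)]) (use assms meet_in in auto)
qed (use assms meet_in meet_le2 in auto)

lemma le_iff_join: "\<lbrakk>x \<in> carr A; y \<in> carr A\<rbrakk> \<Longrightarrow> ba_le A x y \<longleftrightarrow> join A x y = y"
  unfolding ba_le_def by (metis join_absorb join_comm meet_absorb meet_comm)

lemma le_join1: "\<lbrakk>x \<in> carr A; y \<in> carr A\<rbrakk> \<Longrightarrow> ba_le A x (join A x y)"
  by (simp add: ba_le_def meet_absorb)

lemma le_join2: "\<lbrakk>x \<in> carr A; y \<in> carr A\<rbrakk> \<Longrightarrow> ba_le A y (join A x y)"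
  by (metis join_comm le_join1)

lemma join_least:
  "\<lbrakk>ba_le A x z; ba_le A y z; x \<in> carr A; y \<in> carr A; z \<in> carr A\<rbrakk> \<Longrightarrow> ba_le A (join A x y) z"
  by (metis le_iff_join join_assoc join_in)

text \<open>Distributivity splits \<open>w\<close> into its parts below \<open>x\<close> and below
  \<open>neg A x\<close>. This case distinction later combines two failed extensions of a
  filter.\<close>

lemma le_by_cases:
  assumes "w \<in> carr A" "x \<in> carr A" "b \<in> carr A"
    and "ba_le A (meet A w x) b" "ba_le A (meet A w (neg A x)) b"
  shows "ba_le A w b"
proof -
  have "w = join A (meet A w x) (meet A w (neg A x))"
    using assms(1,2) by (metis join_neg meet_join_distrib meet_tp neg_in)
  then show ?thesis
    using assms by (metis join_least meet_in neg_in)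
qed

text \<open>This is the filter generated by \<open>U\<close> and \<open>x\<close>: two witnesses
  \<open>u\<close> and \<open>v\<close> combine to \<open>meet A u v\<close>. It is the competitor
  played against a maximal filter.\<close>

lemma filter_adjoin:
  assumes U: "ba_filter A U" and x: "x \<in> carr A"
  shows "ba_filter A {y \<in> carr A. \<exists>u\<in>U. ba_le A (meet A u x) y}" (is "ba_filter A ?V")
  unfolding ba_filter_def
proof (intro conjI ballI impI)
  have Uc: "u \<in> carr A" if "u \<in> U" for u
    using U that by (auto simp: ba_filter_def)
  show "?V \<subseteq> carr A" by auto
  have "tp A \<in> U" using U by (simp add: ba_filter_def)
  moreover have "ba_le A (meet A (tp A) x) (tp A)"
    using x by (simp add: meet_le1 tp_in)
  ultimately show "tp A \<in> ?V" using tp_in by blast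
  show "meet A y z \<in> ?V" if yz': "y \<in> ?V" "z \<in> ?V" for y z
  proof -
    obtain u v where uv: "u \<in> U" "v \<in> U" and yz: "y \<in> carr A" "z \<in> carr A"
      and le: "ba_le A (meet A u x) y" "ba_le A (meet A v x) z"
      using yz' by blast
    note c = Uc[OF uv(1)] Uc[OF uv(2)]
    have uvU: "meet A u v \<in> U" using U uv by (simp add: ba_filter_def)
    have "ba_le A (meet A (meet A u v) x) (meet A u x)" "ba_le A (meet A (meet A u v) x) (meet A v x)"
      using c x meet_mono_left meet_le1 meet_le2 meet_in by simp_all
    then have "ba_le A (meet A (meet A u v) x) y" "ba_le A (meet A (meet A u v) x) z"
      using le_trans[OF _ le(1)] le_trans[OF _ le(2)] yz c x meet_in by simp_all
    then have "ba_le A (meet A (meet A u v) x) (meet A y z)"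
      using meet_greatest yz c x meet_in by simp
    then show ?thesis using uvU yz meet_in by blast
  qed
  show "z \<in> ?V" if "y \<in> ?V" "z \<in> carr A" "ba_le A y z" for y z
    using that Uc x by (blast intro: le_trans meet_in)
qed

text \<open>Zorn's lemma gives a filter maximal among those that contain \<open>F\<close> and omit
  \<open>b\<close>. If it contained neither \<open>x\<close> nor \<open>neg A x\<close>, adjoining
  either would produce \<open>b\<close>, and a case distinction would put \<open>b\<close> into it
  already. The last clause says that \<open>U\<close> decides every element, which also makes it
  proper.\<close>

theorem ultrafilter_omitting:
  assumes F: "ba_filter A F" and b: "b \<in> carr A" "b \<notin> F"
  obtains U where "ba_filter A U" "F \<subseteq> U" "b \<notin> U"
    "\<And>x. x \<in> carr A \<Longrightarrow> neg A x \<in> U \<longleftrightarrow> x \<notin> U"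
proof -
  define \<F> where "\<F> = {V. ba_filter A V \<and> F \<subseteq> V \<and> b \<notin> V}"
  have "\<exists>U\<in>\<F>. \<forall>V\<in>\<F>. U \<subseteq> V \<longrightarrow> V = U"
  proof (rule subset_Zorn_nonempty)
    show "\<F> \<noteq> {}" using F b by (auto simp: \<F>_def)
    fix \<C> assume ne: "\<C> \<noteq> {}" and chain: "subset.chain \<F> \<C>"
    have mem: "ba_filter A V" "F \<subseteq> V" "b \<notin> V" if "V \<in> \<C>" for V
      using chain that by (auto simp: subset.chain_def \<F>_def)
    have "ba_filter A (\<Union>\<C>)"
      unfolding ba_filter_def
    proof (intro conjI ballI impI)
      show "\<Union>\<C> \<subseteq> carr A" using mem(1) unfolding ba_filter_def by blast
      show "tp A \<in> \<Union>\<C>" using mem(1) ne unfolding ba_filter_def by blast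
      show "meet A x y \<in> \<Union>\<C>" if xy: "x \<in> \<Union>\<C>" "y \<in> \<Union>\<C>" for x y
      proof -
        obtain V W where VW: "V \<in> \<C>" "x \<in> V" "W \<in> \<C>" "y \<in> W" using xy by blast
        then have "V \<subseteq> W \<or> W \<subseteq> V" using chain by (auto simp: subset.chain_def)
        then obtain Z where "Z \<in> \<C>" "x \<in> Z" "y \<in> Z" using VW by blast
        then show ?thesis using mem(1)[of Z] by (auto simp: ba_filter_def)
      qed
      show "y \<in> \<Union>\<C>" if "x \<in> \<Union>\<C>" "y \<in> carr A" "ba_le A x y" for x y
        using that mem(1) unfolding ba_filter_def by blast
    qed
    moreover have "F \<subseteq> \<Union>\<C>" "b \<notin> \<Union>\<C>" using mem(2,3) ne by blast+
    ultimately show "\<Union>\<C> \<in> \<F>" by (simp add: \<F>_def)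
  qed
  then obtain U where U: "ba_filter A U" "F \<subseteq> U" "b \<notin> U"
    and maximal: "\<And>V. \<lbrakk>ba_filter A V; F \<subseteq> V; b \<notin> V; U \<subseteq> V\<rbrakk> \<Longrightarrow> V = U"
    by (auto simp: \<F>_def)
  have Uc: "u \<in> carr A" if "u \<in> U" for u
    using U(1) that by (auto simp: ba_filter_def)
  \<comment> \<open>Adjoining \<open>x\<close> gives a strictly larger filter, which by maximality
    must contain \<open>b\<close>; the inequality expresses that membership.\<close>
  have bounded: "\<exists>u\<in>U. ba_le A (meet A u x) b" if x: "x \<in> carr A" "x \<notin> U" for x
  proof (rule ccontr)
    assume neg: "\<not> ?thesis"
    let ?V = "{y \<in> carr A. \<exists>u\<in>U. ba_le A (meet A u x) y}"
    have "U \<subseteq> ?V" using Uc x(1) meet_le1 by blast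
    moreover have "b \<notin> ?V" using neg by blast
    ultimately have "?V = U"
      using maximal[OF filter_adjoin[OF U(1) x(1)]] U(2) by blast
    moreover have "x \<in> ?V"
      using U(1) x(1) meet_le2 tp_in by (auto simp: ba_filter_def)
    ultimately show False using x(2) by blast
  qed
  have "neg A x \<in> U \<longleftrightarrow> x \<notin> U" if x: "x \<in> carr A" for x
  proof
    assume "neg A x \<in> U"
    show "x \<notin> U"
    proof
      assume "x \<in> U"
      then have "bt A \<in> U"
        using U(1) \<open>neg A x \<in> U\<close> meet_neg[OF x] by (metis ba_filter_def)
      \<comment> \<open>Omitting \<open>b\<close> makes \<open>U\<close> proper: the bottom element
        would bring in everything above it.\<close>
      moreover have "ba_le A (bt A) b" using b by (simp add: ba_le_def meet_bt)
      ultimately show False using U(1,3) b(1) by (auto simp: ba_filter_def)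
    qed
  next
    assume "x \<notin> U"
    show "neg A x \<in> U"
    proof (rule ccontr)
      assume "neg A x \<notin> U"
      then obtain u v where uv: "u \<in> U" "v \<in> U"
        and le: "ba_le A (meet A u x) b" "ba_le A (meet A v (neg A x)) b"
        using bounded[OF x \<open>x \<notin> U\<close>] bounded[OF neg_in[OF x]] by blast
      note c = Uc[OF uv(1)] Uc[OF uv(2)] x neg_in[OF x] b(1)
      \<comment> \<open>This element lies below both witnesses, so a single member of
        \<open>U\<close> serves in both cases.\<close>
      have w: "meet A u v \<in> U" using U(1) uv by (simp add: ba_filter_def)
      have "ba_le A (meet A (meet A u v) x) (meet A u x)"
        "ba_le A (meet A (meet A u v) (neg A x)) (meet A v (neg A x))"
        using c meet_mono_left meet_le1 meet_le2 meet_in by simp_all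
      then have "ba_le A (meet A (meet A u v) x) b" "ba_le A (meet A (meet A u v) (neg A x)) b"
        using le_trans[OF _ le(1)] le_trans[OF _ le(2)] c meet_in by simp_all
      then have "ba_le A (meet A u v) b"
        using le_by_cases[of "meet A u v" x b] c meet_in by blast
      then show False using U(1,3) w b(1) by (auto simp: ba_filter_def)
    qed
  qed
  with U that show ?thesis by blast
qed

section \<open>Meets and joins in ultrafilters\<close>

lemma filter_meet_iff:
  assumes U: "ba_filter A U" and xy: "x \<in> carr A" "y \<in> carr A"
  shows "meet A x y \<in> U \<longleftrightarrow> x \<in> U \<and> y \<in> U"
  using assms meet_le1[OF xy] meet_le2[OF xy] unfolding ba_filter_def by blast

lemma ultrafilter_join_iff:
  assumes U: "ba_filter A U" and ultra: "\<And>x. x \<in> carr A \<Longrightarrow> neg A x \<in> U \<longleftrightarrow> x \<notin> U"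
    and xy: "x \<in> carr A" "y \<in> carr A"
  shows "join A x y \<in> U \<longleftrightarrow> x \<in> U \<or> y \<in> U"
proof
  assume "join A x y \<in> U"
  show "x \<in> U \<or> y \<in> U"
  proof (rule ccontr)
    assume "\<not> (x \<in> U \<or> y \<in> U)"
    then have nx: "neg A x \<in> U" "y \<notin> U" using ultra xy by auto
    then have "meet A (neg A x) (join A x y) \<in> U"
      using U \<open>join A x y \<in> U\<close> by (simp add: ba_filter_def)
    \<comment> \<open>Distributivity cancels \<open>x\<close> from the join, so that
      \<open>y\<close> would have to lie in \<open>U\<close>.\<close>
    also have "meet A (neg A x) (join A x y) = meet A (neg A x) y"
    proof -
      have "meet A (neg A x) (join A x y) = join A (meet A x (neg A x)) (meet A (neg A x) y)"
        using xy by (simp add: meet_join_distrib neg_in meet_comm)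
      then show ?thesis
        using xy join_comm[OF bt_in] by (simp add: meet_neg join_bt meet_in neg_in)
    qed
    finally show False
      using nx(2) filter_meet_iff[OF U neg_in[OF xy(1)] xy(2)] by blast
  qed
next
  assume "x \<in> U \<or> y \<in> U"
  then show "join A x y \<in> U"
    using U xy le_join1[OF xy] le_join2[OF xy] join_in unfolding ba_filter_def by blast
qed

end

section \<open>Representable models\<close>

context boolean_doctrine
begin

text \<open>This is Hom(X, -) with arrows replaced by their codes under \<open>i\<close>, so that
  its values are sets over \<open>'u\<close>. An arrow acts by decoding, composing and encoding
  again; decoding is correct once \<open>i\<close> is injective on \<open>Arr C\<close>.\<close>

definition rep_functor :: "('m \<Rightarrow> 'u) \<Rightarrow> 'o \<Rightarrow> ('o, 'm, 'u) set_functor" where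
  "rep_functor i X = \<lparr>FOb = (\<lambda>Y. i ` Hom C X Y),
     FAr = (\<lambda>g u. i (Cmp C g (inv_into (Arr C) i u)))\<rparr>"

text \<open>An arrow from \<open>X\<close> to \<open>Y\<close> is treated as a generalised element
  of \<open>Y\<close> at stage \<open>X\<close>, and \<open>U\<close> decides which formulas hold
  there.\<close>

definition rep_interp :: "('m \<Rightarrow> 'u) \<Rightarrow> 'o \<Rightarrow> 'b set \<Rightarrow> 'o \<Rightarrow> 'b \<Rightarrow> 'u set" where
  "rep_interp i X U Y \<alpha> = i ` {f \<in> Hom C X Y. Rdx P f \<alpha> \<in> U}"

lemma Hom_Arr: "f \<in> Hom C X Y \<Longrightarrow> f \<in> Arr C"
  by (simp add: Hom_def)

lemma Hom_Obj: "f \<in> Hom C X Y \<Longrightarrow> X \<in> Obj C \<and> Y \<in> Obj C"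
  using Dom_in Cod_in by (auto simp: Hom_def)

lemma FOb_rep: "FOb (rep_functor i X) Y = i ` Hom C X Y"
  by (simp add: rep_functor_def)

lemma FAr_rep:
  assumes "inj_on i (Arr C)" "f \<in> Hom C X Y"
  shows "FAr (rep_functor i X) g (i f) = i (Cmp C g f)"
  using assms by (simp add: rep_functor_def Hom_Arr)

lemma rep_is_set_functor:
  assumes i: "inj_on i (Arr C)"
  shows "is_set_functor C (rep_functor i X)"
  unfolding is_set_functor_def FOb_rep
  by (auto simp: FAr_rep[OF i] FAr_rep[OF i Cmp_in] Cmp_in Cmp_Idn_left Cmp_assoc)

text \<open>Read at stage \<open>X\<close>, the universal properties of terminal objects and
  products say that Hom(X, -) preserves them; injectivity of \<open>i\<close> carries this over to
  codes.\<close>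

lemma rep_preserves_finite_products:
  assumes i: "inj_on i (Arr C)" and X: "X \<in> Obj C"
  shows "preserves_finite_products C (rep_functor i X)"
  unfolding preserves_finite_products_def FOb_rep
proof (intro conjI allI impI)
  fix T assume "is_terminal C T"
  then obtain f where "f \<in> Hom C X T" "\<And>g. g \<in> Hom C X T \<Longrightarrow> g = f"
    using X unfolding is_terminal_def by metis
  then have "Hom C X T = {f}" by blast
  then show "\<exists>!x. x \<in> i ` Hom C X T" by simp
next
  fix X1 X2 Q p1 p2 assume prod: "is_product C X1 X2 Q p1 p2"
  then have p: "p1 \<in> Hom C Q X1" "p2 \<in> Hom C Q X2"
    and univ: "\<And>f1 f2. \<lbrakk>f1 \<in> Hom C X X1; f2 \<in> Hom C X X2\<rbrakk>
      \<Longrightarrow> \<exists>!h. h \<in> Hom C X Q \<and> Cmp C p1 h = f1 \<and> Cmp C p2 h = f2"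
    using X unfolding is_product_def by blast+
  let ?M = "rep_functor i X"
  let ?\<phi> = "\<lambda>x. (FAr ?M p1 x, FAr ?M p2 x)"
  have \<phi>: "?\<phi> (i h) = (i (Cmp C p1 h), i (Cmp C p2 h))" if "h \<in> Hom C X Q" for h
    using FAr_rep[OF i that] by simp
  show "bij_betw ?\<phi> (i ` Hom C X Q) (i ` Hom C X X1 \<times> i ` Hom C X X2)"
    unfolding bij_betw_def
  proof
    show "inj_on ?\<phi> (i ` Hom C X Q)"
    proof (rule inj_onI)
      fix u v assume "u \<in> i ` Hom C X Q" "v \<in> i ` Hom C X Q" and eq: "?\<phi> u = ?\<phi> v"
      then obtain h k where hk: "h \<in> Hom C X Q" "k \<in> Hom C X Q" "u = i h" "v = i k"
        by blast
      note h = Cmp_in[OF hk(1) p(1)] Cmp_in[OF hk(1) p(2)]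
      note k = Cmp_in[OF hk(2) p(1)] Cmp_in[OF hk(2) p(2)]
      have "Cmp C p1 h = Cmp C p1 k" "Cmp C p2 h = Cmp C p2 k"
        using eq \<phi>[OF hk(1)] \<phi>[OF hk(2)] hk(3,4) h k Hom_Arr inj_onD[OF i] by auto
      then show "u = v" using univ[OF h] hk by metis
    qed
    show "?\<phi> ` (i ` Hom C X Q) = i ` Hom C X X1 \<times> i ` Hom C X X2"
    proof
      show "?\<phi> ` (i ` Hom C X Q) \<subseteq> i ` Hom C X X1 \<times> i ` Hom C X X2"
        using \<phi> p Cmp_in by auto
      show "i ` Hom C X X1 \<times> i ` Hom C X X2 \<subseteq> ?\<phi> ` (i ` Hom C X Q)"
      proof
        fix w assume "w \<in> i ` Hom C X X1 \<times> i ` Hom C X X2"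
        then obtain f1 f2 where f: "f1 \<in> Hom C X X1" "f2 \<in> Hom C X X2" "w = (i f1, i f2)"
          by blast
        then obtain h where "h \<in> Hom C X Q" "Cmp C p1 h = f1" "Cmp C p2 h = f2"
          using univ by blast
        then show "w \<in> ?\<phi> ` (i ` Hom C X Q)"
          using \<phi>[of h] f(3) by force
      qed
    qed
  qed
qed

text \<open>Reindexing along an arrow followed by membership in \<open>U\<close> is a homomorphism
  to the two-element algebra, so the interpretation respects the operations pointwise. Naturality
  comes from functoriality of reindexing, \<open>Rdx_Cmp\<close>.\<close>

lemma rep_model:
  assumes i: "inj_on i (Arr C)" and X: "X \<in> Obj C" and U: "ba_filter (Fib P X) U"
    and ultra: "\<And>\<alpha>. \<alpha> \<in> carr (Fib P X) \<Longrightarrow> neg (Fib P X) \<alpha> \<in> U \<longleftrightarrow> \<alpha> \<notin> U"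
  shows "propositional_model C P (rep_functor i X, rep_interp i X U)"
proof -
  let ?M = "rep_functor i X" and ?m = "rep_interp i X U"
  interpret BX: bool_alg "Fib P X" using X by (rule Fib_ba)
  \<comment> \<open>If \<open>Y\<close> is not an object, there are no arrows into it and all the
    sets involved are empty, so \<open>Y\<close> may be arbitrary.\<close>
  have "ba_hom (Fib P Y) (powerset_ba (FOb ?M Y)) (?m Y)" for Y
  proof -
    \<comment> \<open>Injectivity lets images under \<open>i\<close> commute with intersections and
      complements of sets of arrows.\<close>
    have inj: "inj_on i (Hom C X Y)"
      using i by (rule inj_on_subset) (auto simp: Hom_def)
    have hom: "ba_hom (Fib P Y) (Fib P X) (Rdx P f)" if "f \<in> Hom C X Y" for f
      using Rdx_hom that .
    have in_X: "Rdx P f \<alpha> \<in> carr (Fib P X)" if "f \<in> Hom C X Y" "\<alpha> \<in> carr (Fib P Y)" for f \<alpha>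
      using hom[OF that(1)] that(2) by (auto simp: ba_hom_def)
    have tpU: "tp (Fib P X) \<in> U" using U by (simp add: ba_filter_def)
    \<comment> \<open>Applying \<open>ultra\<close> to the bottom element then shows that
      \<open>U\<close> is proper.\<close>
    moreover have "neg (Fib P X) (bt (Fib P X)) = tp (Fib P X)"
      using BX.join_neg[OF BX.bt_in] BX.join_bt BX.join_comm BX.bt_in BX.neg_in by metis
    ultimately have btU: "bt (Fib P X) \<notin> U" using ultra[OF BX.bt_in] by simp
    have meetU: "Rdx P f (meet (Fib P Y) \<alpha> \<beta>) \<in> U \<longleftrightarrow> Rdx P f \<alpha> \<in> U \<and> Rdx P f \<beta> \<in> U"
      if "f \<in> Hom C X Y" "\<alpha> \<in> carr (Fib P Y)" "\<beta> \<in> carr (Fib P Y)" for f \<alpha> \<beta>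
      using hom[OF that(1)] that in_X BX.filter_meet_iff[OF U] by (simp add: ba_hom_def)
    have joinU: "Rdx P f (join (Fib P Y) \<alpha> \<beta>) \<in> U \<longleftrightarrow> Rdx P f \<alpha> \<in> U \<or> Rdx P f \<beta> \<in> U"
      if "f \<in> Hom C X Y" "\<alpha> \<in> carr (Fib P Y)" "\<beta> \<in> carr (Fib P Y)" for f \<alpha> \<beta>
      using hom[OF that(1)] that in_X BX.ultrafilter_join_iff[OF U ultra] by (simp add: ba_hom_def)
    have negU: "Rdx P f (neg (Fib P Y) \<alpha>) \<in> U \<longleftrightarrow> Rdx P f \<alpha> \<notin> U"
      if "f \<in> Hom C X Y" "\<alpha> \<in> carr (Fib P Y)" for f \<alpha>
      using hom[OF that(1)] that in_X ultra by (simp add: ba_hom_def)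
    have bdU: "Rdx P f (bt (Fib P Y)) \<notin> U" "Rdx P f (tp (Fib P Y)) \<in> U" if "f \<in> Hom C X Y" for f
      using hom[OF that] btU tpU by (simp_all add: ba_hom_def)
    have "?m Y (meet (Fib P Y) \<alpha> \<beta>) = ?m Y \<alpha> \<inter> ?m Y \<beta>"
      if "\<alpha> \<in> carr (Fib P Y)" "\<beta> \<in> carr (Fib P Y)" for \<alpha> \<beta>
      unfolding rep_interp_def using meetU that
      by (subst inj_on_image_Int[OF inj, symmetric]) (auto intro!: arg_cong[where f = "image i"])
    moreover have "?m Y (join (Fib P Y) \<alpha> \<beta>) = ?m Y \<alpha> \<union> ?m Y \<beta>"
      if "\<alpha> \<in> carr (Fib P Y)" "\<beta> \<in> carr (Fib P Y)" for \<alpha> \<beta>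
      unfolding rep_interp_def using joinU that by auto
    moreover have "?m Y (neg (Fib P Y) \<alpha>) = i ` Hom C X Y - ?m Y \<alpha>"
      if "\<alpha> \<in> carr (Fib P Y)" for \<alpha>
      unfolding rep_interp_def using negU that
      by (subst inj_on_image_set_diff[OF inj, symmetric]) (auto intro!: arg_cong[where f = "image i"])
    moreover have "?m Y (bt (Fib P Y)) = {}" "?m Y (tp (Fib P Y)) = i ` Hom C X Y"
      unfolding rep_interp_def using bdU by auto
    moreover have "?m Y \<alpha> \<subseteq> i ` Hom C X Y" for \<alpha>
      unfolding rep_interp_def by auto
    ultimately show ?thesis
      unfolding ba_hom_def powerset_ba_def FOb_rep by simp
  qed
  moreover have "?m Y (Rdx P g \<alpha>) = FAr ?M g -` ?m Z \<alpha> \<inter> FOb ?M Y"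
    if g: "g \<in> Hom C Y Z" and \<alpha>: "\<alpha> \<in> carr (Fib P Z)" for Y Z g \<alpha>
  proof -
    have "i f \<in> ?m Y (Rdx P g \<alpha>) \<longleftrightarrow> FAr ?M g (i f) \<in> ?m Z \<alpha>" if f: "f \<in> Hom C X Y" for f
    proof -
      \<comment> \<open>By injectivity a code lies in the interpretation only through its own
        arrow.\<close>
      have mem: "i h \<in> ?m W \<gamma> \<longleftrightarrow> Rdx P h \<gamma> \<in> U" if "h \<in> Hom C X W" for h W \<gamma>
        using that inj_onD[OF i] Hom_Arr unfolding rep_interp_def by blast
      show ?thesis
        using mem[OF f] mem[OF Cmp_in[OF f g]] FAr_rep[OF i f] Rdx_Cmp[OF f g \<alpha>] by simp
    qed
    moreover have "?m Y (Rdx P g \<alpha>) \<subseteq> i ` Hom C X Y"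
      unfolding rep_interp_def by auto
    ultimately show ?thesis unfolding FOb_rep by blast
  qed
  ultimately show ?thesis
    unfolding propositional_model_def
    using rep_is_set_functor[OF i] rep_preserves_finite_products[OF i X] by simp
qed

section \<open>The theory of a model\<close>

definition theory_of :: "('o, 'm, 'b, 'u) pmodel \<Rightarrow> 'o \<Rightarrow> 'b set" where
  "theory_of N X = {\<alpha> \<in> carr (Fib P X). FOb (fst N) X \<subseteq> snd N X \<alpha>}"

text \<open>Grouping the points of one model into its theory lets a class of models be handled like
  a family of ultrafilters.\<close>

lemma valid_in_models_iff:
  "valid_in_models C P \<M> F
     \<longleftrightarrow> (\<forall>X\<in>Obj C. F X = {\<alpha> \<in> carr (Fib P X). \<forall>N\<in>\<M>. \<alpha> \<in> theory_of N X})"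
  unfolding valid_in_models_def theory_of_def
  by (rule ball_cong[OF refl]) (fastforce simp: case_prod_unfold)

text \<open>The defining conditions are closure conditions, so they pass to intersections; an empty
  \<open>\<G>\<close> gives the full fibres. The lemma serves for classes of models and for families
  of ultrafilters alike.\<close>

lemma universal_filter_Inter:
  assumes "\<And>G. G \<in> \<G> \<Longrightarrow> universal_filter C P G"
    and F: "\<And>X. X \<in> Obj C \<Longrightarrow> F X = {\<alpha> \<in> carr (Fib P X). \<forall>G\<in>\<G>. \<alpha> \<in> G X}"
  shows "universal_filter C P F"
  unfolding universal_filter_def
proof (intro conjI ballI)
  fix X Y f \<alpha> assume "X \<in> Obj C" "Y \<in> Obj C" "f \<in> Hom C X Y" "\<alpha> \<in> F Y"
  then show "Rdx P f \<alpha> \<in> F X"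
    using F assms(1) Rdx_hom[of f X Y] by (auto simp: universal_filter_def ba_hom_def)
next
  fix X assume X: "X \<in> Obj C"
  then interpret BX: bool_alg "Fib P X" by (rule Fib_ba)
  have "ba_filter (Fib P X) (G X)" if "G \<in> \<G>" for G
    using assms(1)[OF that] X by (simp add: universal_filter_def)
  then show "ba_filter (Fib P X) (F X)"
    unfolding F[OF X] ba_filter_def using BX.tp_in BX.meet_in by auto
qed

text \<open>Stability under reindexing comes from naturality, the filter laws from the
  interpretations being homomorphisms, the disjunction condition from preservation of products, and
  consistency from preservation of terminal objects.\<close>

lemma theory_of_universal_ultrafilter:
  assumes "propositional_model C P N"
  shows "universal_ultrafilter C P (theory_of N)"
proof -
  obtain M m where N: "N = (M, m)" by (cases N)
  have M: "is_set_functor C M" "preserves_finite_products C M"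
    and hom: "\<And>X. X \<in> Obj C \<Longrightarrow> ba_hom (Fib P X) (powerset_ba (FOb M X)) (m X)"
    and nat: "\<And>X Y f \<alpha>. \<lbrakk>f \<in> Hom C X Y; \<alpha> \<in> carr (Fib P Y)\<rbrakk>
        \<Longrightarrow> m X (Rdx P f \<alpha>) = FAr M f -` m Y \<alpha> \<inter> FOb M X"
    using assms unfolding N propositional_model_def by (simp_all add: Hom_Obj)
  have arr: "FAr M f x \<in> FOb M Y" if "f \<in> Hom C X Y" "x \<in> FOb M X" for X Y f x
    using M(1) Hom_Obj[OF that(1)] that unfolding is_set_functor_def by blast
  have terminal: "\<exists>!x. x \<in> FOb M T" if "is_terminal C T" for T
    using M(2) that unfolding preserves_finite_products_def by blast
  have prod: "bij_betw (\<lambda>x. (FAr M p1 x, FAr M p2 x)) (FOb M Q) (FOb M X1 \<times> FOb M X2)"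
    if "is_product C X1 X2 Q p1 p2" for X1 X2 Q p1 p2
    using M(2) that unfolding preserves_finite_products_def by blast
  have Rdx_in: "Rdx P f \<alpha> \<in> carr (Fib P X)" if "f \<in> Hom C X Y" "\<alpha> \<in> carr (Fib P Y)" for X Y f \<alpha>
    using Rdx_hom[OF that(1)] that(2) by (auto simp: ba_hom_def)
  have "Rdx P f \<alpha> \<in> theory_of N X" if "f \<in> Hom C X Y" "\<alpha> \<in> theory_of N Y" for X Y f \<alpha>
    using that(2) nat[OF that(1)] Rdx_in[OF that(1)]
    by (auto simp: theory_of_def N intro: subsetD[OF _ arr[OF that(1)]])
  moreover have "ba_filter (Fib P X) (theory_of N X)" if X: "X \<in> Obj C" for X
  proof -
    interpret BX: bool_alg "Fib P X" using X by (rule Fib_ba)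
    have "m X x \<subseteq> m X y" if "ba_le (Fib P X) x y" "x \<in> carr (Fib P X)" "y \<in> carr (Fib P X)" for x y
    proof -
      have "m X (meet (Fib P X) x y) = m X x \<inter> m X y"
        using hom[OF X] that by (simp add: ba_hom_def powerset_ba_def)
      then show ?thesis using that(1) by (auto simp: ba_le_def)
    qed
    note mono = subsetD[OF this]
    show ?thesis
      using hom[OF X] BX.tp_in BX.meet_in
      unfolding ba_filter_def theory_of_def N ba_hom_def powerset_ba_def by (auto intro: mono)
  qed
  moreover have "\<alpha>1 \<in> theory_of N X1 \<or> \<alpha>2 \<in> theory_of N X2"
    if Q: "is_product C X1 X2 Q p1 p2" and \<alpha>: "\<alpha>1 \<in> carr (Fib P X1)" "\<alpha>2 \<in> carr (Fib P X2)"
      and join: "join (Fib P Q) (Rdx P p1 \<alpha>1) (Rdx P p2 \<alpha>2) \<in> theory_of N Q"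
    for X1 X2 Q p1 p2 \<alpha>1 \<alpha>2
  proof (rule ccontr)
    assume "\<not> ?thesis"
    then obtain x1 x2 where x: "x1 \<in> FOb M X1" "x1 \<notin> m X1 \<alpha>1" "x2 \<in> FOb M X2" "x2 \<notin> m X2 \<alpha>2"
      using \<alpha> by (auto simp: theory_of_def N)
    \<comment> \<open>Surjectivity of the comparison map joins the two counterexamples into one
      point. The join holds there, yet naturality refutes both of its members.\<close>
    have "(x1, x2) \<in> (\<lambda>x. (FAr M p1 x, FAr M p2 x)) ` FOb M Q"
      using prod[OF Q] x by (simp add: bij_betw_def)
    then obtain x where x': "x \<in> FOb M Q" "FAr M p1 x = x1" "FAr M p2 x = x2" by auto
    have p: "p1 \<in> Hom C Q X1" "p2 \<in> Hom C Q X2" "Q \<in> Obj C"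
      using Q by (auto simp: is_product_def)
    have "m Q (join (Fib P Q) (Rdx P p1 \<alpha>1) (Rdx P p2 \<alpha>2)) = m Q (Rdx P p1 \<alpha>1) \<union> m Q (Rdx P p2 \<alpha>2)"
      using hom[OF p(3)] Rdx_in[OF p(1) \<alpha>(1)] Rdx_in[OF p(2) \<alpha>(2)]
      by (simp add: ba_hom_def powerset_ba_def)
    then have "x \<in> m Q (Rdx P p1 \<alpha>1) \<union> m Q (Rdx P p2 \<alpha>2)"
      using join x'(1) by (auto simp: theory_of_def N)
    then show False
      using nat[OF p(1) \<alpha>(1)] nat[OF p(2) \<alpha>(2)] x x' by auto
  qed
  \<comment> \<open>The one-element set \<open>FOb M T\<close> is not contained in the empty set
    that interprets bottom.\<close>
  moreover have "bt (Fib P T) \<notin> theory_of N T" if T: "is_terminal C T" for T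
    using terminal[OF T] hom[of T] T
    by (auto simp: theory_of_def N is_terminal_def ba_hom_def powerset_ba_def)
  ultimately show ?thesis
    unfolding universal_ultrafilter_def universal_filter_def consistent_family_def by blast
qed

lemma theory_of_universal_filter:
  "propositional_model C P N \<Longrightarrow> universal_filter C P (theory_of N)"
  using theory_of_universal_ultrafilter universal_ultrafilter_def by blast

text \<open>An ultrafilter extending \<open>F X\<close> and omitting \<open>\<beta>\<close> provides
  a representable model. It serves both characterisations of \<open>F\<close>, since its theory is
  also a universal ultrafilter.\<close>

lemma universal_filter_model:
  assumes F: "universal_filter C P F" and X: "X \<in> Obj C"
    and \<beta>: "\<beta> \<in> carr (Fib P X)" "\<beta> \<notin> F X" and i: "inj_on (i :: 'm \<Rightarrow> 'u) (Arr C)"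
  obtains N :: "('o, 'm, 'b, 'u) pmodel"
  where "propositional_model C P N" "family_subset C F (theory_of N)" "\<beta> \<notin> theory_of N X"
proof -
  interpret BX: bool_alg "Fib P X" using X by (rule Fib_ba)
  have "ba_filter (Fib P X) (F X)" using F X by (simp add: universal_filter_def)
  then obtain U where U: "ba_filter (Fib P X) U" "F X \<subseteq> U" "\<beta> \<notin> U"
    and ultra: "\<And>\<alpha>. \<alpha> \<in> carr (Fib P X) \<Longrightarrow> neg (Fib P X) \<alpha> \<in> U \<longleftrightarrow> \<alpha> \<notin> U"
    using BX.ultrafilter_omitting[OF _ \<beta>] by blast
  let ?N = "(rep_functor i X, rep_interp i X U)"
  have "family_subset C F (theory_of ?N)"
    unfolding family_subset_def
  proof (intro ballI subsetI)
    fix Y \<alpha> assume Y: "Y \<in> Obj C" and \<alpha>: "\<alpha> \<in> F Y"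
    then have "\<alpha> \<in> carr (Fib P Y)"
      using F by (auto simp: universal_filter_def ba_filter_def)
    \<comment> \<open>Stability of \<open>F\<close> under reindexing brings the formula back to
      \<open>F X\<close>, which lies in \<open>U\<close>.\<close>
    moreover have "Rdx P f \<alpha> \<in> U" if "f \<in> Hom C X Y" for f
      using F U(2) X Y \<alpha> that by (auto simp: universal_filter_def)
    ultimately show "\<alpha> \<in> theory_of ?N Y"
      by (auto simp: theory_of_def FOb_rep rep_interp_def)
  qed
  moreover have "i (Idn C X) \<notin> rep_interp i X U X \<beta>"
  proof
    assume "i (Idn C X) \<in> rep_interp i X U X \<beta>"
    \<comment> \<open>The image only yields some arrow with the code of the identity; injectivity
      identifies the two.\<close>
    then obtain f where "i (Idn C X) = i f" "f \<in> Hom C X X" "Rdx P f \<beta> \<in> U"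
      by (auto simp: rep_interp_def)
    then have "Rdx P (Idn C X) \<beta> \<in> U"
      using inj_onD[OF i] Hom_Arr Idn_in[OF X] by metis
    then show False using U(3) Rdx_Idn[OF X \<beta>(1)] by simp
  qed
  then have "\<beta> \<notin> theory_of ?N X"
    using Idn_in[OF X] by (auto simp: theory_of_def FOb_rep)
  ultimately show ?thesis
    using that rep_model[OF i X U(1) ultra] by blast
qed

end

text \<open>All implications pass through universal filters. The type \<open>'u\<close> is the
  universe of sets, and coding the arrows of \<open>C\<close> in it makes representable models
  available there.\<close>

theorem theoremA4:
  fixes C :: "('o, 'm) cat" and P :: "('o, 'm, 'b) doctrine" and F :: "'o \<Rightarrow> 'b set"
  assumes doctrine: "boolean_doctrine C P"
    and universe_infinite: "infinite (UNIV :: 'u set)"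
    and arrows_small: "Arr C \<lesssim> (UNIV :: 'u set)"
    and fibres_small: "\<forall>X\<in>Obj C. carr (Fib P X) \<lesssim> (UNIV :: 'u set)"
    and family: "\<forall>X\<in>Obj C. F X \<subseteq> carr (Fib P X)"
  shows
    "((\<exists>\<M> :: ('o, 'm, 'b, 'u) pmodel set.
         (\<forall>N\<in>\<M>. propositional_model C P N) \<and> valid_in_models C P \<M> F)
        \<longleftrightarrow> universal_filter C P F) \<and>
     (universal_filter C P F \<longleftrightarrow> intersection_of_ultrafilters C P F) \<and>
     ((\<exists>\<M> :: ('o, 'm, 'b, 'u) pmodel set. \<M> \<noteq> {} \<and>
         (\<forall>N\<in>\<M>. propositional_model C P N) \<and> valid_in_models C P \<M> F)
        \<longleftrightarrow> universal_filter C P F \<and> consistent_family C P F) \<and>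
     (universal_filter C P F \<and> consistent_family C P F
        \<longleftrightarrow> intersection_of_ultrafilters C P F \<and>
            (\<exists>G. universal_ultrafilter C P G \<and> family_subset C F G))"
proof -
  interpret boolean_doctrine C P by (rule doctrine)
  obtain i :: "'m \<Rightarrow> 'u" where i: "inj_on i (Arr C)"
    using arrows_small unfolding lepoll_def by blast
  \<comment> \<open>The largest class of models in which all of \<open>F\<close> is valid; it
    witnesses both versions of the first condition.\<close>
  define \<M>\<^sub>F :: "('o, 'm, 'b, 'u) pmodel set" where
    "\<M>\<^sub>F = {N. propositional_model C P N \<and> family_subset C F (theory_of N)}"
  have models: "\<forall>N\<in>\<M>\<^sub>F. propositional_model C P N" by (simp add: \<M>\<^sub>F_def)
  have subset: "family_subset C F (theory_of N)" if "valid_in_models C P \<M> F" "N \<in> \<M>"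
    for \<M> :: "('o, 'm, 'b, 'u) pmodel set" and N
    using that unfolding valid_in_models_iff family_subset_def by blast
  have filter_of_models: "universal_filter C P F"
    if "\<forall>N\<in>\<M>. propositional_model C P N" "valid_in_models C P \<M> F"
    for \<M> :: "('o, 'm, 'b, 'u) pmodel set"
    by (rule universal_filter_Inter[where \<G> = "theory_of ` \<M>"])
      (use that in \<open>auto simp: theory_of_universal_filter valid_in_models_iff\<close>)
  have valid: "valid_in_models C P \<M>\<^sub>F F" if F: "universal_filter C P F"
    unfolding valid_in_models_iff
  proof (intro ballI set_eqI iffI)
    fix X \<alpha> assume X: "X \<in> Obj C"
    show "\<alpha> \<in> {\<alpha> \<in> carr (Fib P X). \<forall>N\<in>\<M>\<^sub>F. \<alpha> \<in> theory_of N X}" if "\<alpha> \<in> F X"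
      using that X family by (auto simp: \<M>\<^sub>F_def family_subset_def)
    \<comment> \<open>Otherwise a separating model, itself a member of \<open>\<M>\<^sub>F\<close>,
      would refute \<open>\<alpha>\<close>.\<close>
    show "\<alpha> \<in> F X" if "\<alpha> \<in> {\<alpha> \<in> carr (Fib P X). \<forall>N\<in>\<M>\<^sub>F. \<alpha> \<in> theory_of N X}"
      using that universal_filter_model[OF F X _ _ i] unfolding \<M>\<^sub>F_def by blast
  qed
  have intersection: "intersection_of_ultrafilters C P F" if F: "universal_filter C P F"
    unfolding intersection_of_ultrafilters_def
  proof (intro ballI set_eqI iffI)
    fix X \<alpha> assume X: "X \<in> Obj C"
    let ?I = "{\<alpha> \<in> carr (Fib P X).
      \<forall>G. universal_ultrafilter C P G \<and> family_subset C F G \<longrightarrow> \<alpha> \<in> G X}"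
    show "\<alpha> \<in> ?I" if "\<alpha> \<in> F X"
      using that X family by (auto simp: family_subset_def)
    \<comment> \<open>Otherwise the theory of a separating model would be a universal ultrafilter
      that contains \<open>F\<close> and omits \<open>\<alpha>\<close>.\<close>
    show "\<alpha> \<in> F X" if "\<alpha> \<in> ?I"
      using that universal_filter_model[OF F X _ _ i] theory_of_universal_ultrafilter by blast
  qed
  have filter_of_intersection: "universal_filter C P F" if "intersection_of_ultrafilters C P F"
    by (rule universal_filter_Inter[where \<G> = "{G. universal_ultrafilter C P G \<and> family_subset C F G}"])
      (use that in \<open>auto simp: universal_ultrafilter_def intersection_of_ultrafilters_def\<close>)
  have consistent: "consistent_family C P F"
    if "universal_ultrafilter C P G" "family_subset C F G" for G
    using that
    unfolding universal_ultrafilter_def consistent_family_def family_subset_def is_terminal_def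
    by blast
  \<comment> \<open>Consistency supplies a formula outside \<open>F\<close>, namely bottom over a
    terminal object; separating it from \<open>F\<close> yields a model.\<close>
  have nonempty: "\<M>\<^sub>F \<noteq> {}" if F: "universal_filter C P F" "consistent_family C P F"
  proof -
    obtain T where T: "is_terminal C T" using ex_terminal by blast
    then have "T \<in> Obj C" "bt (Fib P T) \<notin> F T"
      using F(2) by (auto simp: is_terminal_def consistent_family_def)
    moreover have "bt (Fib P T) \<in> carr (Fib P T)"
      using \<open>T \<in> Obj C\<close> Fib_ba bool_alg.bt_in by blast
    ultimately show ?thesis
      using universal_filter_model[OF F(1) _ _ _ i] unfolding \<M>\<^sub>F_def by blast
  qed
  \<comment> \<open>The theory of any member of \<open>\<M>\<^sub>F\<close> serves as
    \<open>G\<close>.\<close>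
  have ultrafilter: "\<exists>G. universal_ultrafilter C P G \<and> family_subset C F G" if "\<M>\<^sub>F \<noteq> {}"
    using that theory_of_universal_ultrafilter unfolding \<M>\<^sub>F_def by blast
  have consistent_of_models: "consistent_family C P F"
    if "\<M> \<noteq> {}" "\<forall>N\<in>\<M>. propositional_model C P N" "valid_in_models C P \<M> F"
    for \<M> :: "('o, 'm, 'b, 'u) pmodel set"
    using that subset consistent theory_of_universal_ultrafilter by blast
  have models_iff: "(\<exists>\<M> :: ('o, 'm, 'b, 'u) pmodel set.
      (\<forall>N\<in>\<M>. propositional_model C P N) \<and> valid_in_models C P \<M> F) \<longleftrightarrow> universal_filter C P F"
    using filter_of_models valid models by blast
  have intersection_iff: "universal_filter C P F \<longleftrightarrow> intersection_of_ultrafilters C P F"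
    using intersection filter_of_intersection by blast
  have models_iff': "(\<exists>\<M> :: ('o, 'm, 'b, 'u) pmodel set. \<M> \<noteq> {} \<and>
      (\<forall>N\<in>\<M>. propositional_model C P N) \<and> valid_in_models C P \<M> F)
      \<longleftrightarrow> universal_filter C P F \<and> consistent_family C P F"
    (is "?L \<longleftrightarrow> ?R")
  proof
    assume ?L
    then obtain \<M> :: "('o, 'm, 'b, 'u) pmodel set" where "\<M> \<noteq> {}"
      "\<forall>N\<in>\<M>. propositional_model C P N" "valid_in_models C P \<M> F" by (elim exE conjE)
    then show ?R using filter_of_models consistent_of_models by simp
  next
    assume ?R
    then show ?L using valid models nonempty by (intro exI[of _ \<M>\<^sub>F]) simp
  qed
  have intersection_iff': "universal_filter C P F \<and> consistent_family C P F
      \<longleftrightarrow> intersection_of_ultrafilters C P F \<and>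
        (\<exists>G. universal_ultrafilter C P G \<and> family_subset C F G)"
    using intersection_iff ultrafilter[OF nonempty] consistent by metis
  show ?thesis
    by (intro conjI models_iff intersection_iff models_iff' intersection_iff')
qed

end
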